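(* Let $d\geq 1$ and let $q\in(1,\infty)$ with $q\neq 2$. Let $G=(V,E)$ be a finite simple graph with $|V|\geq 2d$, let $S\subseteq V$ with $|S|=2d$, and let $\tilde G$ be the graph obtained from $G$ by a bracing operation on $S$. If $G$ is independent in $\ell_q^d$, then $\tilde G$ is independent in $\ell_q^{d+1}$.
   Context: All graphs are finite and simple. Bracing operation: let $G=(V,E)$ with $|V|\ge 2d$ and $S\subseteq V$ with $|S|=2d$. The graph $\tilde G$ obtained from $G$ by a bracing operation on $S$ has vertex set $V\cup\{v_0,v_1\}$, where $v_0,v_1$ are two distinct new vertices not in $V$, and edge set $E\cup\{v_0w: w\in S\}\cup\{v_1w:w\in S\}\cup\{v_0v_1\}$. $\ell_q^d$ denotes $\mathbb{R}^d$ with the norm $\|x\|_q=(\sum_{k=1}^d|x_k|^q)^{1/q}$. A placement of $G=(V,E)$ in $\ell_q^d$ is a point $p=(p_v)_{v\in V}\in(\mathbb{R}^d)^V$ with $p_v\ne p_w$ for every edge $vw\in E$. The (altered) rigidity matrix $\tilde R(G,p)$ has rows indexed by $E$ and columns indexed by $V\times\{1,\dots,d\}$; for an edge $e=vw$ and $1\le k\le d$, the $(e,(v,k))$ entry is $\operatorname{sgn}((p_v-p_w)_k)\,|(p_v-p_w)_k|^{q-1}$, the $(e,(w,k))$ entry is its negative, and all other entries in row $e$ are $0$. (The rigidity matrix $R(G,p)$ is obtained by dividing each row $vw$ by the positive scalar $\|p_v-p_w\|_q^{q-2}$, so it has the same rank.) The framework $(G,p)$ is independent if the rows of this matrix are linearly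 independent, and the graph $G$ is independent in $\ell_q^d$ if $(G,p)$ is independent for some placement $p$ in $\ell_q^d$. *)

theory Defs
  imports "HOL-Analysis.Analysis"
begin

definition simple_graph :: "'v set \<Rightarrow> 'v set set \<Rightarrow> bool" where
  "simple_graph V E \<longleftrightarrow> finite V \<and> (\<forall>e\<in>E. e \<subseteq> V \<and> card e = 2)"

definition bracing_vertices :: "'v set \<Rightarrow> 'v \<Rightarrow> 'v \<Rightarrow> 'v set" where
  "bracing_vertices V v0 v1 = V \<union> {v0, v1}"

definition bracing_edges :: "'v set set \<Rightarrow> 'v set \<Rightarrow> 'v \<Rightarrow> 'v \<Rightarrow> 'v set set" where
  "bracing_edges E S v0 v1 = E \<union> {{v0, w} |w. w \<in> S} \<union> {{v1, w} |w. w \<in> S} \<union> {{v0, v1}}"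

text \<open>
  The space of points with coordinates indexed by 1, ..., d.  The dimension is a natural number
  rather than an index type because dimensions d and d + 1 occur together.  Functions are
  extensional, so that equality of functions is equality of points.
\<close>

definition coord_space :: "nat \<Rightarrow> (nat \<Rightarrow> real) set" where
  "coord_space d = {1..d} \<rightarrow>\<^sub>E UNIV"

definition placement :: "nat \<Rightarrow> 'v set \<Rightarrow> 'v set set \<Rightarrow> ('v \<Rightarrow> nat \<Rightarrow> real) \<Rightarrow> bool" where
  "placement d V E p \<longleftrightarrow>
     p \<in> V \<rightarrow> coord_space d \<and> (\<forall>v w. {v, w} \<in> E \<longrightarrow> p v \<noteq> p w)"

text \<open>
  The altered rigidity matrix, whose rows are those of the rigidity matrix for the q-norm scaled
  by positive factors.  For an edge e containing v, the only element of e - {v} is the other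
  endpoint.  No orientation of the edge has to be chosen: exchanging the endpoints changes the
  sign of the entry, as the lemma after the definition shows.
\<close>

definition rigidity_matrix ::
    "real \<Rightarrow> ('v \<Rightarrow> nat \<Rightarrow> real) \<Rightarrow> 'v set \<Rightarrow> 'v \<times> nat \<Rightarrow> real" where
  "rigidity_matrix q p e = (\<lambda>(v, k).
     if v \<in> e
     then (let w = the_elem (e - {v})
           in sgn (p v k - p w k) * \<bar>p v k - p w k\<bar> powr (q - 1))
     else 0)"

lemma rigidity_matrix_edge:
  assumes "v \<noteq> w"
  shows "rigidity_matrix q p {v, w} (v, k) = sgn (p v k - p w k) * \<bar>p v k - p w k\<bar> powr (q - 1)"
    and "rigidity_matrix q p {v, w} (w, k) = - rigidity_matrix q p {v, w} (v, k)"
    and "u \<notin> {v, w} \<Longrightarrow> rigidity_matrix q p {v, w} (u, k) = 0"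
proof -
  have "{v, w} - {v} = {w}" "{v, w} - {w} = {v}"
    using assms by auto
  moreover have "sgn (p w k - p v k) = - sgn (p v k - p w k)"
    by (simp add: sgn_real_def)
  ultimately show
    "rigidity_matrix q p {v, w} (v, k) = sgn (p v k - p w k) * \<bar>p v k - p w k\<bar> powr (q - 1)"
    "rigidity_matrix q p {v, w} (w, k) = - rigidity_matrix q p {v, w} (v, k)"
    "u \<notin> {v, w} \<Longrightarrow> rigidity_matrix q p {v, w} (u, k) = 0"
    by (simp_all add: rigidity_matrix_def abs_minus_commute)
qed

text \<open>
  Linear independence of the rows as a family indexed by R: repeated rows count as dependent.
\<close>

definition rows_independent :: "'r set \<Rightarrow> 'c set \<Rightarrow> ('r \<Rightarrow> 'c \<Rightarrow> real) \<Rightarrow> bool" where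
  "rows_independent R C M \<longleftrightarrow>
     (\<forall>a. (\<forall>j\<in>C. (\<Sum>i\<in>R. a i * M i j) = 0) \<longrightarrow> (\<forall>i\<in>R. a i = 0))"

definition independent_framework ::
    "nat \<Rightarrow> real \<Rightarrow> 'v set \<Rightarrow> 'v set set \<Rightarrow> ('v \<Rightarrow> nat \<Rightarrow> real) \<Rightarrow> bool" where
  "independent_framework d q V E p \<longleftrightarrow>
     rows_independent E (V \<times> {1..d}) (rigidity_matrix q p)"

definition independent_graph :: "nat \<Rightarrow> real \<Rightarrow> 'v set \<Rightarrow> 'v set set \<Rightarrow> bool" where
  "independent_graph d q V E \<longleftrightarrow>
     (\<exists>p. placement d V E p \<and> independent_framework d q V E p)"

end

(* Write f x = sgn x * |x|^(q - 1). Keep G in the hyperplane of height 0 and put v0 at (0,...,0,1)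
   and v1 at (1,...,1,t) with t nonzero. In a row dependency of the braced framework, the column of
   w in S in direction d + 1 makes the coefficients of the edges v0w and v1w proportional, so that
   the columns of v0 and v1 give a linear system with 2d + 1 equations in the 2d + 1 unknowns
   b_w (w in S) and c (the edge v0v1). If its solution is only 0, what remains is a dependency of
   (G,p). Independence is an open condition and, since q differs from 2, the functions f(-x),
   f(1 - x) and 1 are linearly independent on every interval; hence p can be perturbed so that the
   2d x 2d block of the b_w is nonsingular. Then one of t = 1, -1, 2 makes the whole system
   nonsingular, again because q differs from 2. *)

theory Submission
  imports Defs
begin

section \<open>Linear independence of finitely many rows\<close>

lemma rows_independent_mono:
  "rows_independent R C M \<Longrightarrow> C \<subseteq> D \<Longrightarrow> rows_independent R D M"
  unfolding rows_independent_def by (meson subsetD)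

lemma rows_independent_row_nonzero:
  assumes "rows_independent R C M" "finite R" "r \<in> R"
  obtains c where "c \<in> C" "M r c \<noteq> 0"
proof (rule ccontr)
  assume "\<not> thesis"
  then have "\<forall>c\<in>C. M r c = 0"
    using that by blast
  then have "\<forall>j\<in>C. (\<Sum>i\<in>R. of_bool (i = r) * M i j) = 0"
    by (auto intro!: sum.neutral)
  then have "\<forall>i\<in>R. of_bool (i = r) = (0::real)"
    using assms(1) unfolding rows_independent_def by (elim allE[of _ "\<lambda>i. of_bool (i = r)"]) blast
  then show False
    using assms(3) by auto
qed

text \<open>One step of Gaussian elimination with pivot \<open>M r c\<close>: the other rows are
  cleared in column \<open>c\<close>. In any dependency, column \<open>c\<close> forces the
  coefficient of row \<open>r\<close>, so dependencies of all rows and of the reduced rows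
  correspond.\<close>

lemma rows_independent_insert_iff:
  assumes "finite R" "r \<notin> R" "c \<in> C" "M r c \<noteq> 0"
  shows "rows_independent (insert r R) C M \<longleftrightarrow>
    rows_independent R C (\<lambda>i j. M i j - M i c / M r c * M r j)"
    (is "?L \<longleftrightarrow> rows_independent R C ?N")
proof -
  have reduce: "(\<Sum>i\<in>R. a i * ?N i j) =
      (\<Sum>i\<in>R. a i * M i j) - (\<Sum>i\<in>R. a i * M i c) / M r c * M r j" for a j
    by (simp add: right_diff_distrib sum_subtractf sum_distrib_right sum_divide_distrib
        mult.assoc[symmetric])
  show ?thesis
  proof
    assume L: ?L
    show "rows_independent R C ?N"
      unfolding rows_independent_def
    proof (intro allI impI)
      fix a assume a: "\<forall>j\<in>C. (\<Sum>i\<in>R. a i * ?N i j) = 0"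
      define b where "b = a(r := - (\<Sum>i\<in>R. a i * M i c) / M r c)"
      have bR: "(\<Sum>i\<in>R. b i * M i j) = (\<Sum>i\<in>R. a i * M i j)" for j
        using assms(2) by (intro sum.cong) (auto simp: b_def)
      have "(\<Sum>i\<in>insert r R. b i * M i j) = (\<Sum>i\<in>R. a i * ?N i j)" for j
        unfolding reduce using assms by (simp add: bR) (simp add: b_def)
      then have "\<forall>i\<in>insert r R. b i = 0"
        using L a unfolding rows_independent_def by simp
      then show "\<forall>i\<in>R. a i = 0"
        using assms(2) by (auto simp: b_def split: if_splits)
    qed
  next
    assume N: "rows_independent R C ?N"
    show ?L
      unfolding rows_independent_def
    proof (intro allI impI)
      fix a assume "\<forall>j\<in>C. (\<Sum>i\<in>insert r R. a i * M i j) = 0"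
      then have a: "a r * M r j + (\<Sum>i\<in>R. a i * M i j) = 0" if "j \<in> C" for j
        using assms(1,2) that by simp
      have ar: "a r = - (\<Sum>i\<in>R. a i * M i c) / M r c"
        using a[OF assms(3)] assms(4) by (simp add: field_simps)
      have "(\<Sum>i\<in>R. a i * ?N i j) = 0" if "j \<in> C" for j
        unfolding reduce using a[OF that] by (simp add: ar)
      then have *: "\<forall>i\<in>R. a i = 0"
        using N unfolding rows_independent_def by blast
      then have "a r = 0"
        by (simp add: ar)
      with * show "\<forall>i\<in>insert r R. a i = 0"
        by simp
    qed
  qed
qed

text \<open>Openness of independence, by elimination instead of determinants. Row \<open>r\<close>
  of the limit has a nonzero entry; this pivot stays nonzero eventually, and the reduced entries
  converge because the limit of the pivot is nonzero.\<close>

lemma eventually_rows_independent: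
  assumes "finite R" "rows_independent R C M"
    and "\<And>i j. i \<in> R \<Longrightarrow> j \<in> C \<Longrightarrow> ((\<lambda>x. N x i j) \<longlongrightarrow> M i j) F"
  shows "\<forall>\<^sub>F x in F. rows_independent R C (N x)"
  using assms
proof (induction R arbitrary: M N rule: finite_induct)
  case empty
  then show ?case
    by (simp add: rows_independent_def)
next
  case (insert r R)
  obtain c where c: "c \<in> C" "M r c \<noteq> 0"
    using rows_independent_row_nonzero[OF insert.prems(1)] insert.hyps by blast
  have "\<forall>\<^sub>F x in F. rows_independent R C (\<lambda>i j. N x i j - N x i c / N x r c * N x r j)"
  proof (rule insert.IH)
    show "rows_independent R C (\<lambda>i j. M i j - M i c / M r c * M r j)"
      using insert.prems(1) rows_independent_insert_iff[where M = M and c = c, OF insert.hyps c] by blast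
    show "((\<lambda>x. N x i j - N x i c / N x r c * N x r j) \<longlongrightarrow> M i j - M i c / M r c * M r j) F"
      if "i \<in> R" "j \<in> C" for i j
      using that c by (intro tendsto_intros insert.prems(2)) auto
  qed
  moreover have "\<forall>\<^sub>F x in F. N x r c \<noteq> 0"
    using insert.prems(2)[of r c] c by (auto intro: tendsto_imp_eventually_ne)
  ultimately show ?case
    by eventually_elim (simp add: rows_independent_insert_iff[OF insert.hyps c(1)])
qed

text \<open>Functions \<open>F j\<close> that are independent on each set \<open>U w\<close> admit
  sample points, one in each \<open>U w\<close>, whose evaluation vectors are independent. The
  points are chosen one by one: after \<open>u\<close> is fixed, one function is used up to make the
  others vanish at \<open>u\<close>. The roles of rows and columns are exchanged between hypothesis
  and conclusion.\<close>

lemma rows_independent_choose_points: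
  assumes "finite S" "finite J" "card S \<le> card J"
    and "\<And>w. w \<in> S \<Longrightarrow> rows_independent J (U w) F"
  shows "\<exists>z. (\<forall>w\<in>S. z w \<in> U w) \<and> rows_independent S J (\<lambda>w j. F j (z w))"
  using assms
proof (induction S arbitrary: J F rule: finite_induct)
  case empty
  then show ?case
    by (simp add: rows_independent_def)
next
  case (insert s S)
  have "J \<noteq> {}"
    using insert.hyps insert.prems by auto
  then obtain j0 where j0: "j0 \<in> J"
    by blast
  obtain u where u: "u \<in> U s" "F j0 u \<noteq> 0"
    using rows_independent_row_nonzero[OF insert.prems(3)[of s] insert.prems(1) j0] by blast
  \<comment> \<open>\<open>F' j\<close> vanishes at \<open>u\<close>. A dependency of the
    \<open>F' j\<close> with \<open>j\<close> other than \<open>j0\<close> is a dependency of the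
    \<open>F j\<close> once the multiples of \<open>F j0\<close> are collected into one coefficient,
    as \<open>b\<close> does below.\<close>
  define F' where "F' j z = F j z - F j u / F j0 u * F j0 z" for j z
  have "rows_independent (J - {j0}) (U w) F'" if "w \<in> S" for w
    unfolding rows_independent_def
  proof (intro allI impI)
    fix a assume a: "\<forall>z\<in>U w. (\<Sum>j\<in>J - {j0}. a j * F' j z) = 0"
    define b where "b = a(j0 := - (\<Sum>j\<in>J - {j0}. a j * F j u) / F j0 u)"
    have "(\<Sum>j\<in>J. b j * F j z) = (\<Sum>j\<in>J - {j0}. a j * F' j z)" for z
    proof -
      have "(\<Sum>j\<in>J - {j0}. b j * F j z) = (\<Sum>j\<in>J - {j0}. a j * F j z)"
        by (intro sum.cong) (auto simp: b_def)
      then have "(\<Sum>j\<in>J. b j * F j z) = b j0 * F j0 z + (\<Sum>j\<in>J - {j0}. a j * F j z)"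
        using sum.remove[OF insert.prems(1) j0, of "\<lambda>j. b j * F j z"] by simp
      then show ?thesis
        by (simp add: b_def F'_def right_diff_distrib sum_subtractf sum_distrib_right
            sum_divide_distrib mult.assoc[symmetric])
    qed
    then have "\<forall>j\<in>J. b j = 0"
      using insert.prems(3)[of w] that a unfolding rows_independent_def by simp
    then show "\<forall>j\<in>J - {j0}. a j = 0"
      by (auto simp: b_def split: if_splits)
  qed
  moreover have "card S \<le> card (J - {j0})"
    using insert.prems(1,2) insert.hyps j0 by (simp add: card_Diff_singleton)
  ultimately obtain z where z: "\<forall>w\<in>S. z w \<in> U w"
      "rows_independent S (J - {j0}) (\<lambda>w j. F' j (z w))"
    using insert.IH[of "J - {j0}" F'] insert.prems(1) by auto
  define y where "y = z(s := u)"
  have yS: "y w = z w" if "w \<in> S" for w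
    using that insert.hyps by (auto simp: y_def)
  \<comment> \<open>Eliminating column \<open>j0\<close> with row \<open>s\<close>, where
    \<open>y s\<close> is \<open>u\<close>, turns the entry \<open>F j (y w)\<close> into
    \<open>F' j (z w)\<close>, so the induction hypothesis applies to the reduced matrix.\<close>
  have "rows_independent S J (\<lambda>w j. F j (y w) - F j0 (y w) / F j0 (y s) * F j (y s))"
    using rows_independent_mono[OF z(2), of J]
    by (simp add: rows_independent_def yS F'_def y_def[THEN fun_cong, of s] mult.commute)
  then have "rows_independent (insert s S) J (\<lambda>w j. F j (y w))"
    using rows_independent_insert_iff[of S s j0 J "\<lambda>w j. F j (y w)"] insert.hyps j0 u(2)
    by (simp add: y_def)
  moreover have "\<forall>w\<in>insert s S. y w \<in> U w"
    using z(1) u(1) yS by (simp add: y_def[THEN fun_cong, of s])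
  ultimately show ?case
    by blast
qed

section \<open>The odd power function in the matrix entries\<close>

text \<open>For \<open>q > 1\<close> this is the derivative of |x|^q / q. Rigidity matrix entries
  are its values at coordinate differences.\<close>

definition sgn_powr :: "real \<Rightarrow> real \<Rightarrow> real" where
  "sgn_powr q x = sgn x * \<bar>x\<bar> powr (q - 1)"

lemma sgn_powr_0 [simp]: "sgn_powr q 0 = 0"
  and sgn_powr_1 [simp]: "sgn_powr q 1 = 1"
  and sgn_powr_minus [simp]: "sgn_powr q (- x) = - sgn_powr q x"
  and sgn_powr_eq_0_iff [simp]: "sgn_powr q x = 0 \<longleftrightarrow> x = 0"
  by (auto simp: sgn_powr_def sgn_minus sgn_0_0)

lemma tendsto_sgn_powr:
  assumes "1 < q" "(g \<longlongrightarrow> l) F"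
  shows "((\<lambda>x. sgn_powr q (g x)) \<longlongrightarrow> sgn_powr q l) F"
proof -
  \<comment> \<open>Positive and negative parts avoid the jump of \<open>sgn\<close> at 0: a power
    with positive exponent is continuous on the nonnegative reals, including 0.\<close>
  have "sgn_powr q x = max x 0 powr (q - 1) - max (- x) 0 powr (q - 1)" for x
    by (auto simp: sgn_powr_def sgn_real_def max_def)
  moreover have "((\<lambda>x. max (g x) 0 powr (q - 1) - max (- g x) 0 powr (q - 1))
      \<longlongrightarrow> max l 0 powr (q - 1) - max (- l) 0 powr (q - 1)) F"
    using assms by (intro tendsto_diff tendsto_powr' tendsto_max tendsto_minus tendsto_const) auto
  ultimately show ?thesis
    by simp
qed

lemma has_real_derivative_sgn_powr:
  assumes "x \<noteq> 0"
  shows "(sgn_powr q has_real_derivative (q - 1) * \<bar>x\<bar> powr (q - 2)) (at x)"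
proof (cases "x > 0")
  case True
  have "((\<lambda>x. x powr (q - 1)) has_real_derivative (q - 1) * \<bar>x\<bar> powr (q - 2)) (at x)"
    using has_real_derivative_powr[of x "q - 1"] True by simp
  moreover have "\<forall>\<^sub>F y in nhds x. sgn_powr q y = y powr (q - 1)"
    using eventually_nhds_in_open[of "{0<..}" x] True
    by (auto simp: sgn_powr_def elim: eventually_mono)
  ultimately show ?thesis
    by (subst DERIV_cong_ev) auto
next
  case False
  then have "x < 0"
    using assms by simp
  have "((\<lambda>x. - ((- x) powr (q - 1))) has_real_derivative (q - 1) * \<bar>x\<bar> powr (q - 2)) (at x)"
    using DERIV_minus[OF DERIV_chain2[OF has_real_derivative_powr[of "- x" "q - 1"]
          DERIV_minus[OF DERIV_ident]]] \<open>x < 0\<close> by simp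
  moreover have "\<forall>\<^sub>F y in nhds x. sgn_powr q y = - ((- y) powr (q - 1))"
    using eventually_nhds_in_open[of "{..<0}" x] \<open>x < 0\<close>
    by (auto simp: sgn_powr_def elim: eventually_mono)
  ultimately show ?thesis
    by (subst DERIV_cong_ev) auto
qed

text \<open>Differentiation gives a |x|^(q-2) + b |1-x|^(q-2) = 0 away from 0 and 1. Two points at
  which the ratios |x| / |1-x| differ yield a nonsingular system for \<open>a\<close> and
  \<open>b\<close>, since a nonzero power is injective on the positive reals.\<close>

lemma sgn_powr_shift_independent:
  assumes "1 < q" "q \<noteq> 2" "l < u"
    and const: "\<And>x. l < x \<Longrightarrow> x < u \<Longrightarrow> a * sgn_powr q (0 - x) + b * sgn_powr q (1 - x) = K"
  shows "a = 0 \<and> b = 0"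
proof -
  have deriv: "a * \<bar>x\<bar> powr (q - 2) + b * \<bar>1 - x\<bar> powr (q - 2) = 0"
    if x: "l < x" "x < u" "x \<noteq> 0" "x \<noteq> 1" for x
  proof -
    have "((\<lambda>x. sgn_powr q (c - x)) has_real_derivative (q - 1) * \<bar>c - x\<bar> powr (q - 2) * (- 1)) (at x)"
      if "x \<noteq> c" for c
      using that
      by (intro DERIV_chain2[OF has_real_derivative_sgn_powr]) (auto intro!: derivative_eq_intros)
    from DERIV_add[OF DERIV_cmult[OF this[of 0], of a] DERIV_cmult[OF this[of 1], of b]]
    have "((\<lambda>x. a * sgn_powr q (0 - x) + b * sgn_powr q (1 - x)) has_real_derivative
        (1 - q) * (a * \<bar>x\<bar> powr (q - 2) + b * \<bar>1 - x\<bar> powr (q - 2))) (at x)"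
      using x by (simp add: algebra_simps)
    moreover have "((\<lambda>x. a * sgn_powr q (0 - x) + b * sgn_powr q (1 - x)) has_real_derivative 0) (at x)"
    proof (subst DERIV_cong_ev[OF refl _ refl])
      show "\<forall>\<^sub>F x in nhds x. a * sgn_powr q (0 - x) + b * sgn_powr q (1 - x) = K"
        using eventually_nhds_in_open[of "{l<..<u}" x] x const
        by (auto elim!: eventually_mono)
    qed simp
    ultimately show ?thesis
      using DERIV_unique assms(1) by fastforce
  qed
  have inf: "infinite ({l<..<u} - A)" if "finite A" for A
    using that assms(3) by (simp add: infinite_Ioo Diff_infinite_finite)
  obtain x where x: "x \<in> {l<..<u} - {0, 1}"
    using inf[of "{0, 1}"] by (metis finite.emptyI ex_in_conv finite_insert)
  \<comment> \<open>Excluding \<open>x / (2x - 1)\<close> rules out \<open>x (1 - y) = - y (1 - x)\<close>.\<close>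
  obtain y where y: "y \<in> {l<..<u} - {0, 1, x, x / (2 * x - 1)}"
    using inf[of "{0, 1, x, x / (2 * x - 1)}"] by (metis finite.emptyI ex_in_conv finite_insert)
  have ne: "\<bar>x * (1 - y)\<bar> \<noteq> \<bar>y * (1 - x)\<bar>"
  proof
    assume "\<bar>x * (1 - y)\<bar> = \<bar>y * (1 - x)\<bar>"
    then consider "x = y" | "x = y * (2 * x - 1)"
      by (auto simp: abs_eq_iff algebra_simps)
    then show False
    proof cases
      case 2
      then have "2 * x - 1 \<noteq> 0"
        using x by auto
      then show False
        using 2 y by (simp add: field_simps)
    qed (use y in auto)
  qed
  define X X' Y Y' where "X = \<bar>x\<bar> powr (q - 2)" "X' = \<bar>1 - x\<bar> powr (q - 2)"
    "Y = \<bar>y\<bar> powr (q - 2)" "Y' = \<bar>1 - y\<bar> powr (q - 2)"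
  note defs = this
  \<comment> \<open>This is the determinant of the system for \<open>a\<close> and \<open>b\<close>.
    Taking the root of exponent \<open>q - 2\<close> is where \<open>q \<noteq> 2\<close>
    enters.\<close>
  have "X * Y' \<noteq> Y * X'"
  proof
    assume "X * Y' = Y * X'"
    then have "\<bar>x * (1 - y)\<bar> powr (q - 2) = \<bar>y * (1 - x)\<bar> powr (q - 2)"
      by (simp add: defs abs_mult powr_mult)
    then have "(\<bar>x * (1 - y)\<bar> powr (q - 2)) powr (1 / (q - 2)) =
        (\<bar>y * (1 - x)\<bar> powr (q - 2)) powr (1 / (q - 2))"
      by simp
    then show False
      using ne assms(2) by (simp add: powr_powr)
  qed
  moreover have eqs: "a * X + b * X' = 0" "a * Y + b * Y' = 0"
    using deriv[of x] deriv[of y] x y by (auto simp: defs)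
  then have "a * (X * Y' - Y * X') = 0" "b * (X * Y' - Y * X') = 0"
    by algebra+
  ultimately show ?thesis
    by simp
qed

section \<open>Generic perturbation of a placement\<close>

definition coord_box :: "nat \<Rightarrow> real \<Rightarrow> (nat \<Rightarrow> real) \<Rightarrow> (nat \<Rightarrow> real) set" where
  "coord_box d e p = {z \<in> coord_space d. \<forall>k\<in>{1..d}. \<bar>z k - p k\<bar> < e}"

text \<open>A dependency is a sum of functions \<open>g k\<close> of one coordinate each. Moving
  coordinate \<open>k\<close> alone, with the others kept at the centre, shows that
  \<open>g k\<close> is constant on an interval, so both of its coefficients vanish.\<close>

lemma rows_independent_sgn_powr_box:
  assumes "1 < q" "q \<noteq> 2" "0 < e" "p \<in> coord_space d"
  shows "rows_independent ({1..d} \<times> {0, 1}) (coord_box d e p) (\<lambda>(k, c) z. sgn_powr q (c - z k))"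
  unfolding rows_independent_def
proof (intro allI impI ballI)
  fix a and j :: "nat \<times> real"
  assume a: "\<forall>z\<in>coord_box d e p.
      (\<Sum>i\<in>{1..d} \<times> {0, 1}. a i * (case i of (k, c) \<Rightarrow> \<lambda>z. sgn_powr q (c - z k)) z) = 0"
    and j: "j \<in> {1..d} \<times> {0, 1}"
  define g where "g k x = a (k, 0) * sgn_powr q (0 - x) + a (k, 1) * sgn_powr q (1 - x)" for k x
  have g: "(\<Sum>k\<in>{1..d}. g k (z k)) = 0" if "z \<in> coord_box d e p" for z
    using a that by (simp add: sum.cartesian_product' g_def algebra_simps)
  obtain k where k: "k \<in> {1..d}" and jk: "j = (k, 0) \<or> j = (k, 1)"
    using j by auto
  have "a (k, 0) * sgn_powr q (0 - x) + a (k, 1) * sgn_powr q (1 - x) =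
      - (\<Sum>i\<in>{1..d} - {k}. g i (p i))" if "p k - e < x" "x < p k + e" for x
  proof -
    have "p(k := x) \<in> coord_box d e p"
      using assms(3,4) k that by (auto simp: coord_box_def coord_space_def PiE_iff extensional_def)
    from g[OF this] have "g k x + (\<Sum>i\<in>{1..d} - {k}. g i ((p(k := x)) i)) = 0"
      using k by (simp add: sum.remove[of _ k])
    moreover have "(\<Sum>i\<in>{1..d} - {k}. g i ((p(k := x)) i)) = (\<Sum>i\<in>{1..d} - {k}. g i (p i))"
      by (intro sum.cong) auto
    ultimately show ?thesis
      by (simp add: g_def)
  qed
  with assms(3) have "a (k, 0) = 0 \<and> a (k, 1) = 0"
    by (intro sgn_powr_shift_independent[OF assms(1,2), of "p k - e" "p k + e"]) auto
  then show "a j = 0"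
    using jk by auto
qed

text \<open>An edge with coinciding end points would have a zero row, which no independent family
  contains. This supplies the placement condition when a graph is shown to be independent.\<close>

lemma independent_framework_edge_distinct:
  assumes "independent_framework d q V E p" "finite E" "{v, w} \<in> E" "v \<noteq> w"
  shows "p v \<noteq> p w"
proof
  assume "p v = p w"
  have "rigidity_matrix q p {v, w} (u, k) = 0" for u k
  proof -
    have "u = v \<or> u = w \<or> u \<notin> {v, w}"
      by blast
    then show ?thesis
      using rigidity_matrix_edge[OF assms(4), where q = q and p = p and k = k] \<open>p v = p w\<close>
      by (elim disjE) simp_all
  qed
  then show False
    using rows_independent_row_nonzero[OF assms(1)[unfolded independent_framework_def] assms(2,3)]
    by (metis surj_pair)
qed

lemma independent_graphI:
  assumes "simple_graph V E" "p \<in> V \<rightarrow> coord_space d" "independent_framework d q V E p"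
  shows "independent_graph d q V E"
proof -
  have "finite E"
    using assms(1) by (auto simp: simple_graph_def intro: finite_subset[of E "Pow V"])
  moreover have "v \<noteq> w" if "{v, w} \<in> E" for v w
    using assms(1) that by (auto simp: simple_graph_def)
  ultimately show ?thesis
    using assms(2,3) independent_framework_edge_distinct[OF assms(3)]
    unfolding independent_graph_def placement_def by blast
qed

text \<open>The constants 0 and 1 are the first \<open>d\<close> coordinates given later to
  \<open>v0\<close> and \<open>v1\<close>. Points for \<open>S\<close> are chosen in boxes shrinking
  to \<open>p\<close>, which is possible as there are \<open>2 * d\<close> functions and at most
  that many vertices. The resulting placements converge to \<open>p\<close>, so one of them keeps
  the framework independent.\<close>

lemma exists_independent_generic_placement:
  assumes "1 < q" "q \<noteq> 2" "simple_graph V E" "S \<subseteq> V" "card S \<le> 2 * d"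
    and "p \<in> V \<rightarrow> coord_space d" "independent_framework d q V E p"
  obtains p' where "p' \<in> V \<rightarrow> coord_space d" "independent_framework d q V E p'"
    "rows_independent S ({1..d} \<times> {0, 1}) (\<lambda>w (k, c). sgn_powr q (c - p' w k))"
proof -
  have fin: "finite V" "finite S" "finite E"
    using assms(3,4) by (auto simp: simple_graph_def intro: finite_subset finite_subset[of E "Pow V"])
  define ok where "ok n z \<longleftrightarrow> (\<forall>w\<in>S. z w \<in> coord_box d (inverse (Suc n)) (p w)) \<and>
      rows_independent S ({1..d} \<times> {0, 1}) (\<lambda>w (k, c). sgn_powr q (c - z w k))" for n z
  have "\<exists>z. ok n z" for n
  proof -
    have "\<exists>z. (\<forall>w\<in>S. z w \<in> coord_box d (inverse (Suc n)) (p w)) \<and>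
      rows_independent S ({1..d} \<times> {0, 1::real})
        (\<lambda>w j. (case j of (k, c) \<Rightarrow> \<lambda>z. sgn_powr q (c - z k)) (z w))"
      using assms fin
      by (intro rows_independent_choose_points rows_independent_sgn_powr_box)
        (auto simp: card_cartesian_product)
    then show ?thesis
      by (simp add: ok_def case_prod_unfold)
  qed
  then obtain z where z: "\<And>n. ok n (z n)"
    by metis
  define p' where "p' n v = (if v \<in> S then z n v else p v)" for n v
  have lim: "(\<lambda>n. p' n v k) \<longlonglongrightarrow> p v k" if "k \<in> {1..d}" for v k
  proof (cases "v \<in> S")
    case True
    then have "\<bar>z n v k - p v k\<bar> < inverse (Suc n)" for n
      using z[of n] that by (auto simp: ok_def coord_box_def)
    then have "(\<lambda>n. z n v k - p v k) \<longlonglongrightarrow> 0"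
      by (intro Lim_null_comparison[OF _ LIMSEQ_inverse_real_of_nat])
        (auto intro!: always_eventually less_imp_le)
    then show ?thesis
      using True by (simp add: p'_def LIM_zero_iff)
  qed (simp add: p'_def)
  have "\<forall>\<^sub>F n in sequentially. rows_independent E (V \<times> {1..d}) (rigidity_matrix q (p' n))"
  proof (rule eventually_rows_independent[OF fin(3)])
    show "rows_independent E (V \<times> {1..d}) (rigidity_matrix q p)"
      using assms(7) by (simp add: independent_framework_def)
    show "(\<lambda>n. rigidity_matrix q (p' n) e j) \<longlonglongrightarrow> rigidity_matrix q p e j"
      if "j \<in> V \<times> {1..d}" for e j
      using that assms(1)
      by (auto simp: rigidity_matrix_def Let_def sgn_powr_def[symmetric]
          intro!: tendsto_sgn_powr tendsto_diff lim)
  qed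
  then obtain n where n: "rows_independent E (V \<times> {1..d}) (rigidity_matrix q (p' n))"
    using eventually_happens by fastforce
  show thesis
  proof
    show "p' n \<in> V \<rightarrow> coord_space d"
      using assms(6) z[of n] by (auto simp: p'_def ok_def coord_box_def)
    show "independent_framework d q V E (p' n)"
      using n by (simp add: independent_framework_def)
    show "rows_independent S ({1..d} \<times> {0, 1}) (\<lambda>w (k, c). sgn_powr q (c - p' n w k))"
      using z[of n] by (simp add: ok_def p'_def rows_independent_def case_prod_unfold)
  qed
qed

section \<open>The height of the second new vertex\<close>

text \<open>The three conditions are the equilibrium equations at the new vertices, with the weights
  at \<open>v1\<close> already eliminated. If a height fails, its nonzero solution has
  \<open>c \<noteq> 0\<close> by \<open>ind\<close> and can be scaled to \<open>c = 1\<close>. If 1,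
  -1 and 2 all failed, a combination of their solutions would contradict
  \<open>q \<noteq> 2\<close>.\<close>

lemma exists_bracing_height:
  fixes S :: "'v set"
  assumes "q \<noteq> 2"
    and ind: "rows_independent S ({1..d} \<times> {0, 1}) (\<lambda>w (k, c). sgn_powr q (c - p w k))"
  obtains t where "t \<noteq> 0"
    "\<And>b c. \<lbrakk>\<And>k. k \<in> {1..d} \<Longrightarrow> (\<Sum>w\<in>S. b w * sgn_powr q (0 - p w k)) = c;
      \<And>k. k \<in> {1..d} \<Longrightarrow> (\<Sum>w\<in>S. b w * sgn_powr q (1 - p w k)) = c * sgn_powr q t;
      (\<Sum>w\<in>S. b w) = - c * sgn_powr q (1 - t)\<rbrakk> \<Longrightarrow> c = 0 \<and> (\<forall>w\<in>S. b w = 0)"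
proof (rule ccontr)
  assume contra: "\<not> thesis"
  note witness = that
  define bal where "bal t b c \<longleftrightarrow>
      (\<forall>k\<in>{1..d}. (\<Sum>w\<in>S. b w * sgn_powr q (0 - p w k)) = c) \<and>
      (\<forall>k\<in>{1..d}. (\<Sum>w\<in>S. b w * sgn_powr q (1 - p w k)) = c * sgn_powr q t) \<and>
      (\<Sum>w\<in>S. b w) = - c * sgn_powr q (1 - t)" for t b c
  have unique: "\<forall>w\<in>S. b w = 0"
    if "\<And>k. k \<in> {1..d} \<Longrightarrow> (\<Sum>w\<in>S. b w * sgn_powr q (0 - p w k)) = 0"
      "\<And>k. k \<in> {1..d} \<Longrightarrow> (\<Sum>w\<in>S. b w * sgn_powr q (1 - p w k)) = 0" for b
    using ind that unfolding rows_independent_def by auto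
  have ex: "\<exists>b. bal t b 1" if "t \<noteq> 0" for t
  proof -
    have "\<exists>b c. bal t b c \<and> \<not> (c = 0 \<and> (\<forall>w\<in>S. b w = 0))"
    proof (rule ccontr)
      assume none: "\<not> ?thesis"
      have thesis
      proof (rule witness[OF \<open>t \<noteq> 0\<close>])
        fix b c
        assume "\<And>k. k \<in> {1..d} \<Longrightarrow> (\<Sum>w\<in>S. b w * sgn_powr q (0 - p w k)) = c"
          "\<And>k. k \<in> {1..d} \<Longrightarrow> (\<Sum>w\<in>S. b w * sgn_powr q (1 - p w k)) = c * sgn_powr q t"
          "(\<Sum>w\<in>S. b w) = - c * sgn_powr q (1 - t)"
        then have "bal t b c"
          unfolding bal_def by blast
        then show "c = 0 \<and> (\<forall>w\<in>S. b w = 0)"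
          using none by blast
      qed
      then show False
        using contra by blast
    qed
    then obtain b c where bc: "bal t b c" "\<not> (c = 0 \<and> (\<forall>w\<in>S. b w = 0))"
      by blast
    have "c \<noteq> 0"
      using bc unique[of b] by (auto simp: bal_def)
    then have "bal t (\<lambda>w. b w / c) 1"
      using bc(1) by (simp add: bal_def sum_divide_distrib[symmetric] del: diff_0)
    then show ?thesis
      by blast
  qed
  obtain b1 b2 b3 where b: "bal 1 b1 1" "bal (- 1) b2 1" "bal 2 b3 1"
    using ex[of 1] ex[of "- 1"] ex[of 2] by auto
  define m where "m = sgn_powr q 2"
  \<comment> \<open>By linearity in \<open>c\<close> and \<open>c f(t)\<close>, these weights cancel both \<open>1 + 1 + 1\<close> and
    \<open>f(1), f(-1), f(2) = 1, -1, m\<close>, but not \<open>f(1 - t) = 0, m, -1\<close>.\<close>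
  define b where "b w = - (m + 1) * b1 w + (m - 1) * b2 w + 2 * b3 w" for w
  have sum_b: "(\<Sum>w\<in>S. b w * h w) =
      - (m + 1) * (\<Sum>w\<in>S. b1 w * h w) + (m - 1) * (\<Sum>w\<in>S. b2 w * h w) + 2 * (\<Sum>w\<in>S. b3 w * h w)"
    for h
    unfolding b_def sum_distrib_left sum.distrib[symmetric]
    by (intro sum.cong) (auto simp: algebra_simps)
  have "\<forall>w\<in>S. b w = 0"
    using b by (intro unique) (simp_all add: sum_b bal_def m_def del: diff_0)
  then have "(\<Sum>w\<in>S. b w * 1) = 0"
    by simp
  \<comment> \<open>The weight sums of \<open>b1\<close>, \<open>b2\<close>, \<open>b3\<close> are
    0, -m and 1, so the total is 2 - m (m - 1). As \<open>m\<close> is positive, only m = 2 remains,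
    which means q = 2.\<close>
  then have "(m - 2) * (m + 1) = 0"
    using b unfolding sum_b by (simp add: bal_def m_def algebra_simps)
  moreover have "m = 2 powr (q - 1)"
    by (simp add: m_def sgn_powr_def)
  moreover have "2 powr (q - 1) \<noteq> (2::real)"
    using assms(1) powr_inj[of 2 "q - 1" 1] by auto
  ultimately show False
    using powr_ge_zero[of 2 "q - 1"] by auto
qed

section \<open>Row dependencies of the braced framework\<close>

text \<open>The four kinds of edges are disjoint because \<open>v0\<close> and \<open>v1\<close> are
  new and distinct, and for a new vertex \<open>v\<close> the map from \<open>w\<close> to
  \<open>{v, w}\<close> is injective on \<open>S\<close>.\<close>

lemma sum_bracing_edges:
  fixes h :: "'v set \<Rightarrow> real"
  assumes "simple_graph V E" "S \<subseteq> V" "v0 \<notin> V" "v1 \<notin> V" "v0 \<noteq> v1"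
  shows "(\<Sum>e\<in>bracing_edges E S v0 v1. h e) =
    (\<Sum>e\<in>E. h e) + (\<Sum>w\<in>S. h {v0, w}) + (\<Sum>w\<in>S. h {v1, w}) + h {v0, v1}"
proof -
  have fin: "finite S" "finite E"
    using assms(1,2) by (auto simp: simple_graph_def intro: finite_subset finite_subset[of E "Pow V"])
  have E: "e \<subseteq> V" if "e \<in> E" for e
    using assms(1) that by (auto simp: simple_graph_def)
  have img: "{{v, w} |w. w \<in> S} = (\<lambda>w. {v, w}) ` S" for v
    by auto
  have reindex: "(\<Sum>e\<in>(\<lambda>w. {v, w}) ` S. h e) = (\<Sum>w\<in>S. h {v, w})" if "v \<notin> V" for v
    using that assms(2) by (subst sum.reindex) (auto simp: inj_on_def doubleton_eq_iff)
  have "E \<inter> (\<lambda>w. {v0, w}) ` S = {}"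
    using E assms by blast
  moreover have "(E \<union> (\<lambda>w. {v0, w}) ` S) \<inter> (\<lambda>w. {v1, w}) ` S = {}"
    using E assms by blast
  moreover have "(E \<union> (\<lambda>w. {v0, w}) ` S \<union> (\<lambda>w. {v1, w}) ` S) \<inter> {{v0, v1}} = {}"
    using E assms by (auto simp: doubleton_eq_iff)
  ultimately show ?thesis
    using fin assms(3,4) unfolding bracing_edges_def img
    by (simp add: sum.union_disjoint reindex del: Un_insert_right)
qed

theorem theorem3p3:
  fixes d :: nat and q :: real
    and V S :: "'v set" and E :: "'v set set" and v0 v1 :: 'v
  assumes "d \<ge> 1"
    and "1 < q" and "q \<noteq> 2"
    and "simple_graph V E"
    and "card V \<ge> 2 * d"
    and "S \<subseteq> V" and "card S = 2 * d"
    and "v0 \<notin> V" and "v1 \<notin> V" and "v0 \<noteq> v1"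
    and "independent_graph d q V E"
  shows "independent_graph (d + 1) q (bracing_vertices V v0 v1) (bracing_edges E S v0 v1)"
proof -
  let ?f = "sgn_powr q"
  have edge: "\<exists>u w. e = {u, w} \<and> u \<in> V \<and> w \<in> V \<and> u \<noteq> w" if "e \<in> E" for e
    using assms(4) that by (fastforce simp: simple_graph_def card_2_iff)
  have E: "e \<subseteq> V" if "e \<in> E" for e
    using assms(4) that by (auto simp: simple_graph_def)
  obtain p0 where "p0 \<in> V \<rightarrow> coord_space d" "independent_framework d q V E p0"
    using assms(11) by (auto simp: independent_graph_def placement_def)
  then obtain p where p: "p \<in> V \<rightarrow> coord_space d" "independent_framework d q V E p"
    and gen: "rows_independent S ({1..d} \<times> {0, 1}) (\<lambda>w (k, c). ?f (c - p w k))"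
    using exists_independent_generic_placement[OF assms(2-4,6)] assms(7) by (metis order_refl)
  obtain t where t: "t \<noteq> 0"
    and nonsing: "\<And>b c. \<lbrakk>\<And>k. k \<in> {1..d} \<Longrightarrow> (\<Sum>w\<in>S. b w * ?f (0 - p w k)) = c;
      \<And>k. k \<in> {1..d} \<Longrightarrow> (\<Sum>w\<in>S. b w * ?f (1 - p w k)) = c * ?f t;
      (\<Sum>w\<in>S. b w) = - c * ?f (1 - t)\<rbrakk> \<Longrightarrow> c = 0 \<and> (\<forall>w\<in>S. b w = 0)"
    using exists_bracing_height[OF assms(3) gen] by blast
  \<comment> \<open>Restriction makes the new points extensional. At an old vertex only coordinate
    \<open>d + 1\<close> changes, from the default \<open>undefined\<close> to height 0.\<close>
  define p' where "p' v =
    (if v = v0 then (\<lambda>k\<in>{1..d+1}. if k = d + 1 then 1 else 0)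
     else if v = v1 then (\<lambda>k\<in>{1..d+1}. if k = d + 1 then t else 1)
     else (p v)(d + 1 := 0))" for v
  have p'V: "p' v k = p v k" if "v \<in> V" "k \<in> {1..d}" for v k
    using that assms(8,9) by (auto simp: p'_def)
  have p'V_top: "p' v (d + 1) = 0" if "v \<in> V" for v
    using that assms(8,9) by (auto simp: p'_def)
  have p'0: "p' v0 k = 0" if "k \<in> {1..d}" for k
    using that by (auto simp: p'_def)
  have p'1: "p' v1 k = 1" if "k \<in> {1..d}" for k
    using that assms(10) by (auto simp: p'_def)
  have top: "p' v0 (d + 1) = 1" "p' v1 (d + 1) = t"
    using assms(10) by (auto simp: p'_def)
  let ?M = "rigidity_matrix q p'"
  note M = rigidity_matrix_edge[where q = q and p = p', folded sgn_powr_def]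
  have M2: "?M {v, w} (w, k) = - ?f (p' v k - p' w k)" if "v \<noteq> w" for v w k
    using M(1,2)[OF that] by simp
  have M_other: "?M e (v, k) = 0" if "v \<notin> e" for e v k
    using that by (simp add: rigidity_matrix_def)
  show ?thesis
  proof (rule independent_graphI)
    show "simple_graph (bracing_vertices V v0 v1) (bracing_edges E S v0 v1)"
    proof -
      have "card {v, w} = 2" if "v \<notin> V" "w \<in> S" for v w
        using that assms(6) by (auto simp: card_insert_if)
      then show ?thesis
        using assms(4,6,8-10)
        by (auto simp: simple_graph_def bracing_vertices_def bracing_edges_def)
    qed
    show "p' \<in> bracing_vertices V v0 v1 \<rightarrow> coord_space (d + 1)"
    proof -
      have "p v k = undefined" if "v \<in> V" "\<not> (Suc 0 \<le> k \<and> k \<le> d)" for v k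
        using p(1) that by (intro PiE_arb[of "p v" "{1..d}" "\<lambda>_. UNIV"]) (auto simp: coord_space_def)
      then show ?thesis
        by (auto simp: p'_def bracing_vertices_def coord_space_def PiE_iff extensional_def)
    qed
    show "independent_framework (d + 1) q (bracing_vertices V v0 v1) (bracing_edges E S v0 v1) p'"
      unfolding independent_framework_def rows_independent_def
    proof (intro allI impI)
      fix a
      assume zero: "\<forall>j\<in>bracing_vertices V v0 v1 \<times> {1..d + 1}.
        (\<Sum>e\<in>bracing_edges E S v0 v1. a e * ?M e j) = 0"
      have a: "(\<Sum>e\<in>E. a e * ?M e (v, k)) + (\<Sum>w\<in>S. a {v0, w} * ?M {v0, w} (v, k)) +
          (\<Sum>w\<in>S. a {v1, w} * ?M {v1, w} (v, k)) + a {v0, v1} * ?M {v0, v1} (v, k) = 0"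
        if "v \<in> V \<union> {v0, v1}" "k \<in> {1..d + 1}" for v k
      proof -
        have "(\<Sum>e\<in>bracing_edges E S v0 v1. a e * ?M e (v, k)) = 0"
          using zero that unfolding bracing_vertices_def by blast
        then show ?thesis
          unfolding sum_bracing_edges[OF assms(4,6,8-10)] .
      qed
      define b0 b1 where "b0 w = a {v0, w}" "b1 w = a {v1, w}" for w
      define c where "c = a {v0, v1}"
      note defs = b0_b1_def c_def
      have S: "w \<in> V" "w \<noteq> v0" "w \<noteq> v1" "v0 \<noteq> w" "v1 \<noteq> w" if "w \<in> S" for w
        using that assms(6,8,9) by auto
      have E_new: "(\<Sum>e\<in>E. a e * ?M e (v, k)) = 0" if "v \<notin> V" for v k
        using that E by (intro sum.neutral) (auto intro!: M_other)
      have col0: "(\<Sum>w\<in>S. b0 w * ?f (p' v0 k - p' w k)) + c * ?f (p' v0 k - p' v1 k) = 0"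
        if "k \<in> {1..d + 1}" for k
      proof -
        have "(\<Sum>w\<in>S. a {v0, w} * ?M {v0, w} (v0, k)) = (\<Sum>w\<in>S. b0 w * ?f (p' v0 k - p' w k))"
          using S by (intro sum.cong) (simp_all add: M(1) defs)
        moreover have "(\<Sum>w\<in>S. a {v1, w} * ?M {v1, w} (v0, k)) = 0"
          using S assms(10) by (intro sum.neutral) (auto intro!: M_other)
        ultimately show ?thesis
          using a[of v0 k] that assms(8,10) by (simp add: E_new M(1) M2 defs)
      qed
      have col1: "(\<Sum>w\<in>S. b1 w * ?f (p' v1 k - p' w k)) - c * ?f (p' v0 k - p' v1 k) = 0"
        if "k \<in> {1..d + 1}" for k
      proof -
        have "(\<Sum>w\<in>S. a {v1, w} * ?M {v1, w} (v1, k)) = (\<Sum>w\<in>S. b1 w * ?f (p' v1 k - p' w k))"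
          using S by (intro sum.cong) (simp_all add: M(1) defs)
        moreover have "(\<Sum>w\<in>S. a {v0, w} * ?M {v0, w} (v1, k)) = 0"
          using S assms(10) by (intro sum.neutral) (auto intro!: M_other)
        ultimately show ?thesis
          using a[of v1 k] that assms(9,10) by (simp add: E_new M(1) M2 defs)
      qed
      \<comment> \<open>Column \<open>(w, d + 1)\<close>: edges of \<open>G\<close> contribute 0, as
        both ends have height 0, while the edges to \<open>v0\<close> and \<open>v1\<close>
        contribute - b0 w f(1) and - b1 w f(t), with f(1) = 1.\<close>
      have colw: "b0 w = - (b1 w * ?f t)" if w: "w \<in> S" for w
      proof -
        have "(\<Sum>e\<in>E. a e * ?M e (w, d + 1)) = 0"
        proof (intro sum.neutral ballI)
          fix e assume e: "e \<in> E"
          then obtain u v where uv: "e = {u, v}" "u \<in> V" "v \<in> V" "u \<noteq> v"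
            using edge by blast
          consider "w = u" | "w = v" | "w \<notin> {u, v}"
            by blast
          then show "a e * ?M e (w, d + 1) = 0"
            using uv p'V_top[OF uv(2)] p'V_top[OF uv(3)] by cases (simp_all add: M(1) M2 M_other)
        qed
        moreover have "(\<Sum>u\<in>S. a {v, u} * ?M {v, u} (w, d + 1)) = - (a {v, w} * ?f (p' v (d + 1)))"
          if "v \<notin> V" for v
        proof -
          have "finite S"
            using assms(1,7) card.infinite by fastforce
          then have "(\<Sum>u\<in>S. a {v, u} * ?M {v, u} (w, d + 1)) = a {v, w} * ?M {v, w} (w, d + 1)"
            using w that S(1) by (subst sum.remove[of _ w]) (auto intro!: sum.neutral M_other)
          then show ?thesis
            using p'V_top[OF S(1)[OF w]] M2[of v w "d + 1"] S(1)[OF w] that by (cases "v = w") simp_all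
        qed
        ultimately show ?thesis
          using a[of w "d + 1"] S[OF w] assms(8,9) M_other[of w "{v0, v1}"] top
          by (simp add: defs)
      qed
      have "c = 0 \<and> (\<forall>w\<in>S. b0 w = 0)"
      \<comment> \<open>The equations come from the first \<open>d\<close> columns of
        \<open>v0\<close>, from those of \<open>v1\<close> multiplied by - f(t), which turns
        \<open>b1\<close> into \<open>b0\<close>, and from the last column of
        \<open>v0\<close>.\<close>
      proof (rule nonsing)
        show "(\<Sum>w\<in>S. b0 w * ?f (0 - p w k)) = c" if "k \<in> {1..d}" for k
        proof -
          have "(\<Sum>w\<in>S. b0 w * ?f (p' v0 k - p' w k)) = (\<Sum>w\<in>S. b0 w * ?f (0 - p w k))"
            using S that by (intro sum.cong) (simp_all add: p'V p'0)
          then show ?thesis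
            using col0[of k] that by (simp add: p'0 p'1)
        qed
        show "(\<Sum>w\<in>S. b0 w * ?f (1 - p w k)) = c * ?f t" if "k \<in> {1..d}" for k
        proof -
          have "(\<Sum>w\<in>S. b0 w * ?f (1 - p w k)) = - ?f t * (\<Sum>w\<in>S. b1 w * ?f (p' v1 k - p' w k))"
            unfolding sum_distrib_left
            using S that by (intro sum.cong) (simp_all add: p'V p'1 colw)
          then show ?thesis
            using col1[of k] that by (simp add: p'0 p'1)
        qed
        have "(\<Sum>w\<in>S. b0 w * ?f (p' v0 (d + 1) - p' w (d + 1))) = (\<Sum>w\<in>S. b0 w)"
          using S p'V_top top by (intro sum.cong) simp_all
        then show "(\<Sum>w\<in>S. b0 w) = - c * ?f (1 - t)"
          using col0[of "d + 1"] top by simp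
      qed
      then have c: "c = 0" and b0: "\<forall>w\<in>S. b0 w = 0"
        by auto
      \<comment> \<open>Since \<open>t\<close> is nonzero, so is f(t), and the proportionality can
        be inverted.\<close>
      then have b1: "\<forall>w\<in>S. b1 w = 0"
        using colw t by auto
      \<comment> \<open>With the coefficients of all new edges zero, the columns in directions up to
        \<open>d\<close> see only \<open>G\<close>, where \<open>p'\<close> and \<open>p\<close>
        agree.\<close>
      have "(\<Sum>e\<in>E. a e * rigidity_matrix q p e (v, k)) = 0" if "v \<in> V" "k \<in> {1..d}" for v k
      proof -
        have "rigidity_matrix q p e (v, k) = ?M e (v, k)" if "e \<in> E" for e
        proof -
          obtain u w where uw: "e = {u, w}" "u \<in> V" "w \<in> V" "u \<noteq> w"
            using edge \<open>e \<in> E\<close> by blast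
          have "p' u k = p u k" "p' w k = p w k"
            using p'V uw \<open>k \<in> {1..d}\<close> by auto
          moreover have "rigidity_matrix q r {u, w} (w, k) = - rigidity_matrix q r {u, w} (u, k)" for r
            using rigidity_matrix_edge(2)[OF uw(4)] .
          moreover have "v = u \<or> v = w \<or> v \<notin> {u, w}"
            by blast
          ultimately show ?thesis
            using uw M(1)[of u w k] rigidity_matrix_edge(1)[OF uw(4), where q = q and p = p]
            by (elim disjE) (simp_all add: sgn_powr_def rigidity_matrix_edge(1,3))
        qed
        moreover have "(\<Sum>w\<in>S. a {v0, w} * ?M {v0, w} (v, k)) = 0"
            "(\<Sum>w\<in>S. a {v1, w} * ?M {v1, w} (v, k)) = 0" "a {v0, v1} = 0"
          using b0 b1 c by (auto simp: defs)
        ultimately show ?thesis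
          using a[of v k] that by simp
      qed
      then have "\<forall>e\<in>E. a e = 0"
        using p(2) unfolding independent_framework_def rows_independent_def by auto
      then show "\<forall>e\<in>bracing_edges E S v0 v1. a e = 0"
        using b0 b1 c by (auto simp: defs bracing_edges_def)
    qed
  qed
qed

end
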